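(* Let $L=(G,l)$ be a linkage with $M(L)\ne\emptyset$, and suppose there are vertices $u\ne v$ of $G$ with \[(G,u,v)=(P_1,u,v)\|(P_2,u,v)\|\cdots\|(P_n,u,v)\|(K,u,v),\qquad n\ge2,\] where each $P_i$ is a path graph joining $u$ and $v$ whose edges all have positive length, and $K$ is either empty (the factor being absent) or such that $(K,u,v)$ is a TTSPG. Regard each $P_i$ as a path linkage with the restricted lengths and terminal vertices $u,v$. If $\nabla(P_i)\cap[L,u,v]=\emptyset$ for some $i$, then $M(L)$ is disconnected.
   Context: A graph has a finite vertex set and a finite multiset of edges that are unordered pairs of distinct vertices. A linkage is $L=(G,l)$ with $l:E\to\mathbb R_{\ge0}$; $C(L)=\{p:V\to\mathbb R^2:|p(u)-p(v)|=l(\{u,v\})\ \forall\{u,v\}\in E\}$, and $M(L)$ is the quotient of $C(L)$ by the group of orientation preserving isometries of $\mathbb R^2$ (quotient topology). $[L,u,v]=\{|p(u)-p(v)|:p\in M(L)\}$. Parallel composition of TTGs: $(G_1,s_1,t_1)\|(G_2,s_2,t_2)=(G_1\cup_{s_1\sim s_2,t_1\sim t_2}G_2,s_1,t_1)$; series composition $(G_1,s_1,t_1)\circ(G_2,s_2,t_2)=(G_1\cup_{t_2\sim s_1}G_2,s_2,t_1)$; TTSPGs form the smallest class of TTGs containing a single edge and closed under both compositions. For a path linkage $P$ with terminal vertices (endpoints) $s,t$, let $\theta:M(P)\to\mathbb R$, $\theta(p)=|p(s)-p(t)|$, $[P]=\theta(M(P))$, and $\nabla(P)=\{x\in[P]:\theta^{-1}(x)\text{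 is connected}\}$. *)

theory Defs
  imports "HOL-Analysis.Analysis"
begin

text \<open>Multigraphs: a vertex set V, a set E of edge identifiers and an endpoint map
  ends :: 'e => 'v * 'v (the edge e is the unordered pair {fst (ends e), snd (ends e)}).
  Using edge identifiers models a multiset of edges with independent lengths.
  The plane R^2 is represented by the complex numbers.\<close>

definition endpts :: "('e \<Rightarrow> 'v \<times> 'v) \<Rightarrow> 'e \<Rightarrow> 'v set" where
  "endpts ends e = {fst (ends e), snd (ends e)}"

definition verts :: "('e \<Rightarrow> 'v \<times> 'v) \<Rightarrow> 'e set \<Rightarrow> 'v set" where
  "verts ends A = (\<Union>e\<in>A. endpts ends e)"

definition graph :: "'v set \<Rightarrow> 'e set \<Rightarrow> ('e \<Rightarrow> 'v \<times> 'v) \<Rightarrow> bool" where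
  "graph V E ends \<longleftrightarrow> finite V \<and> finite E \<and>
     (\<forall>e\<in>E. fst (ends e) \<noteq> snd (ends e) \<and> fst (ends e) \<in> V \<and> snd (ends e) \<in> V)"

definition config_space ::
  "'v set \<Rightarrow> 'e set \<Rightarrow> ('e \<Rightarrow> 'v \<times> 'v) \<Rightarrow> ('e \<Rightarrow> real) \<Rightarrow> ('v \<Rightarrow> complex) set" where
  "config_space V E ends l =
     {p \<in> extensional V. \<forall>e\<in>E. cmod (p (fst (ends e)) - p (snd (ends e))) = l e}"

definition config_top ::
  "'v set \<Rightarrow> 'e set \<Rightarrow> ('e \<Rightarrow> 'v \<times> 'v) \<Rightarrow> ('e \<Rightarrow> real) \<Rightarrow> ('v \<Rightarrow> complex) topology" where
  "config_top V E ends l =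
     subtopology (product_topology (\<lambda>_. euclidean) V) (config_space V E ends l)"

definition orbit :: "'v set \<Rightarrow> ('v \<Rightarrow> complex) \<Rightarrow> ('v \<Rightarrow> complex) set" where
  "orbit V p = {restrict (\<lambda>x. a * p x + b) V | a b. cmod a = 1}"

definition quotient_topology :: "'a topology \<Rightarrow> ('a \<Rightarrow> 'b) \<Rightarrow> 'b topology" where
  "quotient_topology X f =
     topology (\<lambda>U. U \<subseteq> f ` topspace X \<and> openin X {x \<in> topspace X. f x \<in> U})"

definition moduli_top ::
  "'v set \<Rightarrow> 'e set \<Rightarrow> ('e \<Rightarrow> 'v \<times> 'v) \<Rightarrow> ('e \<Rightarrow> real) \<Rightarrow> ('v \<Rightarrow> complex) set topology" where
  "moduli_top V E ends l = quotient_topology (config_top V E ends l) (orbit V)"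

definition moduli_space ::
  "'v set \<Rightarrow> 'e set \<Rightarrow> ('e \<Rightarrow> 'v \<times> 'v) \<Rightarrow> ('e \<Rightarrow> real) \<Rightarrow> ('v \<Rightarrow> complex) set set" where
  "moduli_space V E ends l = orbit V ` config_space V E ends l"

definition dist_range ::
  "'v set \<Rightarrow> 'e set \<Rightarrow> ('e \<Rightarrow> 'v \<times> 'v) \<Rightarrow> ('e \<Rightarrow> real) \<Rightarrow> 'v \<Rightarrow> 'v \<Rightarrow> real set" where
  "dist_range V E ends l u v = {cmod (p u - p v) | p. p \<in> config_space V E ends l}"

text \<open>theta : M(L) -> R, well-defined on orbits.\<close>
definition theta :: "'v \<Rightarrow> 'v \<Rightarrow> ('v \<Rightarrow> complex) set \<Rightarrow> real" where
  "theta s t c = (SOME x. \<exists>p\<in>c. x = cmod (p s - p t))"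

definition nabla ::
  "'v set \<Rightarrow> 'e set \<Rightarrow> ('e \<Rightarrow> 'v \<times> 'v) \<Rightarrow> ('e \<Rightarrow> real) \<Rightarrow> 'v \<Rightarrow> 'v \<Rightarrow> real set" where
  "nabla V E ends l s t =
     {x \<in> theta s t ` moduli_space V E ends l.
        connectedin (moduli_top V E ends l) {c \<in> moduli_space V E ends l. theta s t c = x}}"

definition is_path :: "('e \<Rightarrow> 'v \<times> 'v) \<Rightarrow> 'e set \<Rightarrow> 'v \<Rightarrow> 'v \<Rightarrow> bool" where
  "is_path ends A u v \<longleftrightarrow>
     (\<exists>xs es. es \<noteq> [] \<and> length xs = length es + 1 \<and> distinct xs \<and> distinct es \<and>
        hd xs = u \<and> last xs = v \<and> set es = A \<and>
        (\<forall>j<length es. endpts ends (es ! j) = {xs ! j, xs ! Suc j}))"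

text \<open>Two-terminal series-parallel graphs, realised by their edge sets.
  Parallel: the two parts share exactly the terminals.
  Series (G1,s1,t1) o (G2,s2,t2): glue t2 ~ s1, terminals (s2,t1).\<close>
inductive ttspg :: "('e \<Rightarrow> 'v \<times> 'v) \<Rightarrow> 'e set \<Rightarrow> 'v \<Rightarrow> 'v \<Rightarrow> bool" for ends where
  edge: "fst (ends e) \<noteq> snd (ends e) \<Longrightarrow> endpts ends e = {s, t} \<Longrightarrow> ttspg ends {e} s t"
| par: "ttspg ends A s t \<Longrightarrow> ttspg ends B s t \<Longrightarrow> A \<inter> B = {} \<Longrightarrow>
        verts ends A \<inter> verts ends B = {s, t} \<Longrightarrow> ttspg ends (A \<union> B) s t"
| ser: "ttspg ends A s1 t1 \<Longrightarrow> ttspg ends B s2 s1 \<Longrightarrow> A \<inter> B = {} \<Longrightarrow>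
        verts ends A \<inter> verts ends B = {s1} \<Longrightarrow> ttspg ends (A \<union> B) s2 t1"

end

(* Close the path P_i with the diagonal uv to a polygon with side lengths a_1, ..., a_k, x, where
   x = |p(u) - p(v)|, and call three sides long if any two of them together exceed half the
   perimeter.

   Without three long sides, the polygons with these side lengths form a connected space: delete
   the sides one at a time, keeping track of the interval of admissible lengths of the resulting
   diagonal.  The polygons in which the deleted side turns left (right) of the diagonal fibre over
   the shorter chains with connected fibres, and the two halves meet unless no admissible
   configuration has the side collinear with the diagonal; that failure forces three long sides.

   So the hypothesis on nabla gives every p in C(L) a long triple.  The triple is unique and locally
   constant in p, and two sides of it can never be collinear.  Hence the sign of the determinant of
   two path sides of a fixed triple cuts out a clopen subset of M(L); a global reflection changes
   the sign, so this subset is neither empty nor everything. *)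

theory Submission
  imports Defs
begin

section \<open>Connectedness of spaces of planar chains\<close>


lemma law_of_cosines_cis:
  "(cmod (of_real r * cis t + of_real a * cis (t + s)))\<^sup>2 = r\<^sup>2 + a\<^sup>2 + 2 * r * a * cos s"
proof -
  \<comment> \<open>Rotation by \<open>- t\<close> puts the first side on the real axis;
    \<open>s\<close> is the exterior angle, whence the plus sign in front of the cosine.\<close>
  have "of_real r * cis t + of_real a * cis (t + s) = cis t * (of_real r + of_real a * cis s)"
    by (simp add: cis_mult[symmetric] algebra_simps)
  then have "(cmod (of_real r * cis t + of_real a * cis (t + s)))\<^sup>2 = (cmod (of_real r + of_real a * cis s))\<^sup>2"
    by (simp add: norm_mult)
  also have "\<dots> = (r + a * cos s)\<^sup>2 + (a * sin s)\<^sup>2"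
    by (simp add: cmod_power2)
  also have "\<dots> = r\<^sup>2 + a\<^sup>2 * ((cos s)\<^sup>2 + (sin s)\<^sup>2) + 2 * r * a * cos s"
    by (simp only: power2_eq_square) algebra
  finally show ?thesis by simp
qed

lemma Im_cnj_cis: "Im (cnj (of_real r * cis t) * cis (t + s)) = r * sin s"
proof -
  have "cnj (of_real r * cis t) * cis (t + s) = of_real r * cis s"
    by (simp add: cis_cnj cis_mult)
  then show ?thesis by (simp only:) simp
qed

text \<open>Intermediate value theorem: while the side of length \<open>a\<close> turns left from
  the direction of \<open>w\<close> to the opposite one, the length of the sum moves continuously
  from \<open>cmod w + a\<close> to \<open>\<bar>cmod w - a\<bar>\<close>.\<close>

lemma ex_unit_third_side:
  assumes "0 \<le> a" "\<bar>cmod w - a\<bar> \<le> r" "r \<le> cmod w + a"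
  shows "\<exists>\<zeta>. cmod \<zeta> = 1 \<and> 0 \<le> Im (cnj w * \<zeta>) \<and> cmod (w + of_real a * \<zeta>) = r"
proof -
  define t where "t = Arg w"
  define q where "q = cmod w"
  have w: "w = of_real q * cis t"
    unfolding t_def q_def by (metis rcis_cmod_Arg rcis_def)
  have q: "0 \<le> q" by (simp add: q_def)
  note assms = assms[folded q_def]
  define g where "g s = cmod (of_real q * cis t + of_real a * cis (t + s))" for s
  have "(g s)\<^sup>2 = q\<^sup>2 + a\<^sup>2 + 2 * q * a * cos s" for s
    unfolding g_def by (rule law_of_cosines_cis)
  from this[of 0] this[of pi] have "(g 0)\<^sup>2 = (q + a)\<^sup>2" "(g pi)\<^sup>2 = \<bar>q - a\<bar>\<^sup>2"
    by (simp_all add: power2_sum power2_diff)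
  moreover have "0 \<le> g s" for s by (simp add: g_def)
  ultimately have g0: "g 0 = q + a" and gpi: "g pi = \<bar>q - a\<bar>"
    using assms q by (metis add_nonneg_nonneg power2_eq_imp_eq, metis abs_ge_zero power2_eq_imp_eq)
  have "continuous_on {0..pi} g"
    unfolding g_def by (intro continuous_intros)
  then obtain s where s: "0 \<le> s" "s \<le> pi" "g s = r"
    using IVT2'[of g pi r 0] g0 gpi assms by auto
  show ?thesis
  proof (intro exI conjI)
    show "0 \<le> Im (cnj w * cis (t + s))"
      unfolding w Im_cnj_cis using s q by (intro mult_nonneg_nonneg sin_ge_zero)
    show "cmod (w + of_real a * cis (t + s)) = r"
      using s by (subst w) (simp add: g_def)
  qed simp
qed

text \<open>On this half circle the length of the sum decreases weakly with the turning angle, so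
  \<open>lo\<close> and \<open>hi\<close> cut out an interval of angles. If \<open>w = 0\<close>,
  the length is constant and the set is the full circle or empty.\<close>

lemma connected_half_annulus_directions:
  assumes "0 \<le> a" "0 \<le> lo"
  shows "connected {\<zeta>. cmod \<zeta> = 1 \<and> 0 \<le> Im (cnj w * \<zeta>) \<and>
           lo \<le> cmod (w + of_real a * \<zeta>) \<and> cmod (w + of_real a * \<zeta>) \<le> hi}" (is "connected ?S")
proof (cases "w = 0 \<or> hi < 0")
  case True
  then show ?thesis
  proof
    assume "w = 0"
    then have "?S = (if lo \<le> a \<and> a \<le> hi then sphere 0 1 else {})"
      using assms by (auto simp: norm_mult)
    then show ?thesis
      by (simp add: connected_sphere)
  next
    assume "hi < 0"
    then have "\<not> cmod (w + of_real a * \<zeta>) \<le> hi" for \<zeta>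
      by (meson linorder_not_less norm_ge_zero order.strict_trans2)
    then show ?thesis by simp
  qed
next
  case False
  define t where "t = Arg w"
  define r where "r = cmod w"
  have w: "w = of_real r * cis t"
    unfolding t_def r_def by (metis rcis_cmod_Arg rcis_def)
  have r: "r > 0" using False by (simp add: r_def)
  define J where "J = {s \<in> {0..pi}. lo\<^sup>2 \<le> r\<^sup>2 + a\<^sup>2 + 2 * r * a * cos s \<and> r\<^sup>2 + a\<^sup>2 + 2 * r * a * cos s \<le> hi\<^sup>2}"
  have "is_interval J"
    unfolding is_interval_1
  proof (intro ballI allI impI)
    fix x y s assume xy: "x \<in> J" "y \<in> J" and s: "x \<le> s \<and> s \<le> y"
    then have c: "cos s \<le> cos x" "cos y \<le> cos s" "s \<in> {0..pi}"
      by (auto simp: J_def intro!: cos_monotone_0_pi_le)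
    have "2 * r * a * cos s \<le> 2 * r * a * cos x" "2 * r * a * cos y \<le> 2 * r * a * cos s"
      using c r assms by (auto intro!: mult_left_mono)
    then show "s \<in> J"
      using xy c unfolding J_def by auto
  qed
  then have "connected J" by (simp add: is_interval_connected)
  then have "connected ((\<lambda>s. cis (t + s)) ` J)"
    by (intro connected_continuous_image continuous_intros)
  moreover have "(\<lambda>s. cis (t + s)) ` J = ?S"
  proof -
    have mem: "cis (t + s) \<in> ?S \<longleftrightarrow> 0 \<le> sin s \<and> lo\<^sup>2 \<le> r\<^sup>2 + a\<^sup>2 + 2 * r * a * cos s
        \<and> r\<^sup>2 + a\<^sup>2 + 2 * r * a * cos s \<le> hi\<^sup>2" for s
    proof -
      have "lo \<le> cmod (w + of_real a * cis (t + s)) \<longleftrightarrow> lo\<^sup>2 \<le> (cmod (w + of_real a * cis (t + s)))\<^sup>2"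
        using assms by (simp add: abs_le_square_iff[symmetric])
      moreover have "cmod (w + of_real a * cis (t + s)) \<le> hi \<longleftrightarrow> (cmod (w + of_real a * cis (t + s)))\<^sup>2 \<le> hi\<^sup>2"
        using False by (simp add: abs_le_square_iff[symmetric])
      moreover have "0 \<le> Im (cnj w * cis (t + s)) \<longleftrightarrow> 0 \<le> sin s"
        by (subst w, subst Im_cnj_cis) (use r in \<open>simp add: zero_le_mult_iff\<close>)
      moreover have "(cmod (w + of_real a * cis (t + s)))\<^sup>2 = r\<^sup>2 + a\<^sup>2 + 2 * r * a * cos s"
        by (subst w) (rule law_of_cosines_cis)
      ultimately show ?thesis by simp
    qed
    show ?thesis
    proof (intro set_eqI iffI)
      fix \<zeta> assume "\<zeta> \<in> (\<lambda>s. cis (t + s)) ` J"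
      then obtain s where s: "s \<in> J" "\<zeta> = cis (t + s)" by auto
      moreover have "0 \<le> sin s" using s by (auto simp: J_def intro: sin_ge_zero)
      ultimately show "\<zeta> \<in> ?S" by (simp only: mem) (simp add: J_def)
    next
      fix \<zeta> assume z: "\<zeta> \<in> ?S"
      define s where "s = Arg (\<zeta> / cis t)"
      have "cmod (\<zeta> / cis t) = 1" using z by (simp add: norm_divide)
      then have "cis s = \<zeta> / cis t"
        unfolding s_def using cis_Arg[of "\<zeta> / cis t"] by (metis norm_zero zero_neq_one sgn_eq div_by_1 of_real_1)
      then have zs: "\<zeta> = cis (t + s)" by (simp add: cis_mult[symmetric])
      have b: "- pi < s" "s \<le> pi" using Arg_bounded[of "\<zeta> / cis t"] by (auto simp: s_def)
      have m: "0 \<le> sin s" "lo\<^sup>2 \<le> r\<^sup>2 + a\<^sup>2 + 2 * r * a * cos s" "r\<^sup>2 + a\<^sup>2 + 2 * r * a * cos s \<le> hi\<^sup>2"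
        using z unfolding zs mem by auto
      have "0 \<le> s" using b m sin_gt_zero[of "-s"] by force
      then show "\<zeta> \<in> (\<lambda>s. cis (t + s)) ` J" using zs b m by (auto simp: J_def)
    qed
  qed
  ultimately show ?thesis by simp
qed

text \<open>A continuous map from a compact set to a Hausdorff space is closed, and for closed maps
  with connected fibres connectedness of the image lifts to the domain.\<close>

lemma connected_compact_monotone:
  fixes f :: "'a::topological_space \<Rightarrow> 'b::t2_space"
  assumes "compact S" "continuous_on S f" "connected (f ` S)"
    and "\<And>y. y \<in> f ` S \<Longrightarrow> connected (S \<inter> f -` {y})"
  shows "connected S"
proof -
  have "connected (S \<inter> f -` (f ` S))"
  proof (rule connected_closed_monotone_preimage[OF assms(2) refl _ assms(4) assms(3)])
    fix C assume C: "closedin (top_of_set S) C"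
    then have "compact C" using assms(1) by (rule closedin_compact[rotated])
    moreover have "C \<subseteq> S" using C closedin_imp_subset by blast
    ultimately show "closedin (top_of_set (f ` S)) (f ` C)"
      using assms(2) by (intro closed_subset compact_imp_closed compact_continuous_image)
        (auto intro: continuous_on_subset)
  qed auto
  moreover have "S \<inter> f -` (f ` S) = S" by auto
  ultimately show ?thesis by simp
qed

text \<open>The projection \<open>fst\<close> maps \<open>D\<close> onto \<open>W\<close>, by
  \<open>ext\<close>, and its fibres are the connected sets of directions on the left of
  \<open>f z\<close>.\<close>

lemma upper_half_extension:
  fixes W :: "'a::t2_space set" and f :: "'a \<Rightarrow> complex"
  assumes W: "compact W" "connected W" and f: "continuous_on W f"
    and a: "0 \<le> a" "0 \<le> lo"
    and ext: "\<And>z. z \<in> W \<Longrightarrow> \<exists>r. \<bar>cmod (f z) - a\<bar> \<le> r \<and> r \<le> cmod (f z) + a \<and> lo \<le> r \<and> r \<le> hi"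
  defines "D \<equiv> {(z, \<zeta>). z \<in> W \<and> cmod \<zeta> = 1 \<and> 0 \<le> Im (cnj (f z) * \<zeta>) \<and>
           lo \<le> cmod (f z + of_real a * \<zeta>) \<and> cmod (f z + of_real a * \<zeta>) \<le> hi}"
  shows "compact D" "connected D"
proof -
  define g where "g = (\<lambda>(z, \<zeta>). (cmod (f z + of_real a * \<zeta>), Im (cnj (f z) * \<zeta>)))"
  have "continuous_on (W \<times> sphere 0 1) g"
    unfolding g_def case_prod_unfold
    by (intro continuous_intros continuous_on_compose2[OF f]) auto
  then have "closedin (top_of_set (W \<times> sphere 0 1)) ((W \<times> sphere 0 1) \<inter> g -` ({lo..hi} \<times> {0..}))"
    by (intro continuous_closedin_preimage closed_Times closed_atLeastAtMost closed_atLeast)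
  moreover have "(W \<times> sphere 0 1) \<inter> g -` ({lo..hi} \<times> {0..}) = D"
    by (auto simp: D_def g_def)
  ultimately show comp: "compact D"
    using closedin_compact[OF compact_Times[OF W(1) compact_sphere]] by metis
  have img: "fst ` D = W"
  proof (intro set_eqI iffI)
    fix z assume z: "z \<in> W"
    then obtain r where r: "\<bar>cmod (f z) - a\<bar> \<le> r" "r \<le> cmod (f z) + a" "lo \<le> r" "r \<le> hi"
      using ext by blast
    obtain \<zeta> where "cmod \<zeta> = 1 \<and> 0 \<le> Im (cnj (f z) * \<zeta>) \<and> cmod (f z + of_real a * \<zeta>) = r"
      using ex_unit_third_side[OF a(1) r(1,2)] by blast
    then have "(z, \<zeta>) \<in> D" using z r by (auto simp: D_def)
    then show "z \<in> fst ` D" by force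
  qed (auto simp: D_def)
  show "connected D"
  proof (rule connected_compact_monotone[OF comp, of fst])
    show "connected (fst ` D)" using img W by simp
    fix z assume z: "z \<in> fst ` D"
    define Z where "Z = {\<zeta>. cmod \<zeta> = 1 \<and> 0 \<le> Im (cnj (f z) * \<zeta>) \<and>
           lo \<le> cmod (f z + of_real a * \<zeta>) \<and> cmod (f z + of_real a * \<zeta>) \<le> hi}"
    have "connected ({z} \<times> Z)"
      unfolding Z_def by (intro connected_Times connected_half_annulus_directions a connected_sing)
    moreover have "D \<inter> fst -` {z} = {z} \<times> Z"
      using z img by (auto simp: D_def Z_def)
    ultimately show "connected (D \<inter> fst -` {z})" by simp
  qed (intro continuous_intros)
qed

text \<open>The directions left and right of \<open>f z\<close> form two connected halves, and the
  collinear pair \<open>(z0, \<zeta>0)\<close> belongs to both.\<close>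

lemma extension_connected:
  fixes W :: "'a::t2_space set" and f :: "'a \<Rightarrow> complex"
  assumes W: "compact W" "connected W" and f: "continuous_on W f"
    and a: "0 \<le> a" "0 \<le> lo"
    and ext: "\<And>z. z \<in> W \<Longrightarrow> \<exists>r. \<bar>cmod (f z) - a\<bar> \<le> r \<and> r \<le> cmod (f z) + a \<and> lo \<le> r \<and> r \<le> hi"
  defines "D \<equiv> {(z, \<zeta>). z \<in> W \<and> cmod \<zeta> = 1 \<and>
           lo \<le> cmod (f z + of_real a * \<zeta>) \<and> cmod (f z + of_real a * \<zeta>) \<le> hi}"
  assumes col: "(z0, \<zeta>0) \<in> D" "Im (cnj (f z0) * \<zeta>0) = 0"
  shows "compact D" "connected D"
proof -
  define U where "U f = {(z, \<zeta>). z \<in> W \<and> cmod \<zeta> = 1 \<and> 0 \<le> Im (cnj (f z) * \<zeta>) \<and>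
           lo \<le> cmod (f z + of_real a * \<zeta>) \<and> cmod (f z + of_real a * \<zeta>) \<le> hi}" for f
  have up: "compact (U f)" "connected (U f)"
    unfolding U_def by (rule upper_half_extension[OF W f a ext]; assumption)+
  have lo: "compact (U (\<lambda>z. cnj (f z)))" "connected (U (\<lambda>z. cnj (f z)))"
    unfolding U_def using f ext
    by (intro upper_half_extension[OF W _ a] continuous_intros; simp)+
  \<comment> \<open>Reflection exchanges left and right: the right half for \<open>f\<close> is the
    image under \<open>h\<close> of the left half for the conjugate of \<open>f\<close>.\<close>
  define h :: "'a \<times> complex \<Rightarrow> _" where "h = (\<lambda>(z, \<zeta>). (z, cnj \<zeta>))"
  have h: "continuous_on X h" for X
    unfolding h_def case_prod_unfold by (intro continuous_intros)
  have flip: "cmod (cnj w + of_real a * \<zeta>) = cmod (w + of_real a * cnj \<zeta>)" for w \<zeta>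
    by (metis complex_cnj_add complex_cnj_cnj complex_cnj_complex_of_real complex_cnj_mult complex_mod_cnj)
  have hU: "h ` U (\<lambda>z. cnj (f z)) = {(z, \<zeta>) \<in> D. Im (cnj (f z) * \<zeta>) \<le> 0}"
  proof (intro set_eqI iffI)
    fix y assume "y \<in> {(z, \<zeta>) \<in> D. Im (cnj (f z) * \<zeta>) \<le> 0}"
    then obtain z \<zeta> where y: "y = (z, \<zeta>)" "(z, \<zeta>) \<in> D" "Im (cnj (f z) * \<zeta>) \<le> 0" by auto
    then have "(z, cnj \<zeta>) \<in> U (\<lambda>z. cnj (f z))" by (auto simp: U_def D_def flip)
    moreover have "y = h (z, cnj \<zeta>)" by (simp add: h_def y)
    ultimately show "y \<in> h ` U (\<lambda>z. cnj (f z))" by blast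
  qed (auto simp: U_def D_def h_def flip)
  have D: "D = U f \<union> h ` U (\<lambda>z. cnj (f z))"
    unfolding hU by (auto simp: U_def D_def)
  show "compact D"
    unfolding D by (intro compact_Un up compact_continuous_image h lo)
  have "(z0, \<zeta>0) \<in> U f \<inter> h ` U (\<lambda>z. cnj (f z))"
    unfolding hU using col by (auto simp: U_def D_def)
  then show "connected D"
    unfolding D by (intro connected_Un up connected_continuous_image h lo) auto
qed

section \<open>Chains whose sum has its length in a given interval\<close>

definition chain_vec :: "(nat \<Rightarrow> real) \<Rightarrow> nat \<Rightarrow> (nat \<Rightarrow> complex) \<Rightarrow> complex" where
  "chain_vec a k z = (\<Sum>i<k. of_real (a i) * z i)"

text \<open>A chain is recorded by the unit directions of its sides, so a side of length zero still
  has a direction. Coordinates from \<open>k\<close> on are fixed at 0, so that adding a side is a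
  function update at \<open>k\<close>.\<close>

definition chain_set :: "(nat \<Rightarrow> real) \<Rightarrow> nat \<Rightarrow> real \<Rightarrow> real \<Rightarrow> (nat \<Rightarrow> complex) set" where
  "chain_set a k lo hi = {z. (\<forall>i<k. cmod (z i) = 1) \<and> (\<forall>i\<ge>k. z i = 0) \<and>
     lo \<le> cmod (chain_vec a k z) \<and> cmod (chain_vec a k z) \<le> hi}"

lemma chain_vec_upd:
  "chain_vec a k (z(k := \<zeta>)) = chain_vec a k z"
  "chain_vec a (Suc k) (z(k := \<zeta>)) = chain_vec a k z + of_real (a k) * \<zeta>"
  by (auto simp: chain_vec_def)

lemma continuous_on_chain_vec: "continuous_on S (chain_vec a k)"
  unfolding chain_vec_def
  by (intro continuous_intros continuous_on_subset[OF continuous_on_product_coordinates]) auto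

lemma norm_add_unit_bounds:
  assumes "cmod \<zeta> = 1" "0 \<le> a"
  shows "cmod (w + of_real a * \<zeta>) \<le> cmod w + a" "\<bar>cmod w - a\<bar> \<le> cmod (w + of_real a * \<zeta>)"
proof -
  have [simp]: "cmod (of_real a * \<zeta>) = a" using assms by (simp add: norm_mult)
  show "cmod (w + of_real a * \<zeta>) \<le> cmod w + a"
    using norm_triangle_ineq[of w "of_real a * \<zeta>"] by simp
  show "\<bar>cmod w - a\<bar> \<le> cmod (w + of_real a * \<zeta>)"
    using norm_triangle_ineq3[of w "- (of_real a * \<zeta>)"] by simp
qed

text \<open>Deleting the side \<open>k\<close> changes the length of the sum by at most
  \<open>a k\<close>; hence the bounds \<open>lo'\<close> and \<open>hi'\<close> on the shorter
  chain exclude nothing.\<close>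

lemma chain_set_Suc:
  assumes a: "0 \<le> a k"
    and lo': "lo' \<le> max 0 (max (a k - hi) (lo - a k))" and hi': "a k + hi \<le> hi'"
  shows "chain_set a (Suc k) lo hi = (\<lambda>(z, \<zeta>). z(k := \<zeta>)) ` {(z, \<zeta>). z \<in> chain_set a k lo' hi' \<and>
     cmod \<zeta> = 1 \<and> lo \<le> cmod (chain_vec a k z + of_real (a k) * \<zeta>) \<and>
     cmod (chain_vec a k z + of_real (a k) * \<zeta>) \<le> hi}" (is "_ = ?u ` ?D")
proof (intro set_eqI iffI)
  fix y assume y: "y \<in> chain_set a (Suc k) lo hi"
  define z where "z = y(k := 0)"
  have yz: "y = z(k := y k)" by (simp add: z_def)
  have u: "cmod (y k) = 1" using y by (simp add: chain_set_def)
  have b: "lo \<le> cmod (chain_vec a k z + of_real (a k) * y k)"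
     "cmod (chain_vec a k z + of_real (a k) * y k) \<le> hi"
    using y chain_vec_upd(2)[of a k z "y k", folded yz] by (auto simp: chain_set_def)
  have "lo' \<le> cmod (chain_vec a k z)" "cmod (chain_vec a k z) \<le> hi'"
    using b norm_add_unit_bounds[OF u a, of "chain_vec a k z"] lo' hi' norm_ge_zero[of "chain_vec a k z"]
    by linarith+
  then have "z \<in> chain_set a k lo' hi'"
    using y by (auto simp: chain_set_def z_def)
  then have "(z, y k) \<in> ?D" using u b by simp
  moreover have "y = ?u (z, y k)" using yz by simp
  ultimately show "y \<in> ?u ` ?D" by blast
qed (auto simp: chain_set_def chain_vec_upd less_Suc_eq)

text \<open>Induction on the number of sides, with the triangle inequality and its converse. The
  least attainable length \<open>m\<close> is 0 unless one side exceeds all others together, and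
  then it is the excess of that side.\<close>

lemma chain_reach:
  assumes a: "\<And>i. 0 \<le> a i"
  obtains m where "0 \<le> m" "m \<le> sum a {..<k}" "m = 0 \<or> (\<exists>i<k. m = 2 * a i - sum a {..<k})"
    "\<And>r. m \<le> r \<Longrightarrow> r \<le> sum a {..<k} \<Longrightarrow> chain_set a k r r \<noteq> {}"
    "\<And>z lo hi. z \<in> chain_set a k lo hi \<Longrightarrow> m \<le> cmod (chain_vec a k z) \<and> cmod (chain_vec a k z) \<le> sum a {..<k}"
proof (induction k arbitrary: thesis)
  case 0
  show thesis
    by (rule 0[of 0]) (auto simp: chain_set_def chain_vec_def)
next
  case (Suc k)
  obtain m where m: "0 \<le> m" "m \<le> sum a {..<k}" "m = 0 \<or> (\<exists>i<k. m = 2 * a i - sum a {..<k})"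
    "\<And>r. m \<le> r \<Longrightarrow> r \<le> sum a {..<k} \<Longrightarrow> chain_set a k r r \<noteq> {}"
    "\<And>z lo hi. z \<in> chain_set a k lo hi \<Longrightarrow> m \<le> cmod (chain_vec a k z) \<and> cmod (chain_vec a k z) \<le> sum a {..<k}"
    using Suc.IH by blast
  define m' where "m' = max 0 (max (m - a k) (a k - sum a {..<k}))"
  note ak = a[of k]
  show thesis
  proof (rule Suc.prems[of m'])
    show "m' = 0 \<or> (\<exists>i<Suc k. m' = 2 * a i - sum a {..<Suc k})"
    proof (cases "m' = 0 \<or> m' = a k - sum a {..<k}")
      case False
      then have "m' = m - a k" "m \<noteq> 0" using ak by (auto simp: m'_def max_def split: if_splits)
      then show ?thesis using m(3) by (auto intro: less_SucI)
    qed auto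
    fix r assume r: "m' \<le> r" "r \<le> sum a {..<Suc k}"
    \<comment> \<open>The least attainable length of the shorter chain that closes a triangle with
      \<open>a k\<close> and \<open>r\<close>.\<close>
    define s where "s = max m \<bar>r - a k\<bar>"
    have s: "m \<le> s" "s \<le> sum a {..<k}" "\<bar>s - a k\<bar> \<le> r" "r \<le> s + a k"
      using r m ak by (auto simp: s_def m'_def)
    obtain z where z: "z \<in> chain_set a k s s" using m(4) s by blast
    then have "cmod (chain_vec a k z) = s" by (auto simp: chain_set_def)
    then obtain \<zeta> where "cmod \<zeta> = 1" "cmod (chain_vec a k z + of_real (a k) * \<zeta>) = r"
      using ex_unit_third_side[OF ak, of "chain_vec a k z" r] s by auto
    then have "z(k := \<zeta>) \<in> chain_set a (Suc k) r r"
      using z by (auto simp: chain_set_def chain_vec_upd less_Suc_eq)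
    then show "chain_set a (Suc k) r r \<noteq> {}" by blast
  next
    fix z lo hi assume "z \<in> chain_set a (Suc k) lo hi"
    \<comment> \<open>The bounds for \<open>y\<close> are merely weak enough; only that
      \<open>y\<close> is a chain of \<open>k\<close> sides matters.\<close>
    then obtain y \<zeta> where z: "z = y(k := \<zeta>)" "cmod \<zeta> = 1"
        "y \<in> chain_set a k (min 0 (a k - hi)) (a k + hi)"
      by (subst (asm) chain_set_Suc[where a = a and k = k and lo' = "min 0 (a k - hi)" and hi' = "a k + hi"])
        (use ak in auto)
    have y: "m \<le> cmod (chain_vec a k y)" "cmod (chain_vec a k y) \<le> sum a {..<k}"
      using m(5) z by blast+
    show "m' \<le> cmod (chain_vec a (Suc k) z) \<and> cmod (chain_vec a (Suc k) z) \<le> sum a {..<Suc k}"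
      using y norm_add_unit_bounds[OF z(2) ak, of "chain_vec a k y"]
      unfolding z(1) chain_vec_upd m'_def by (auto simp: abs_le_iff)
  qed (use m ak in \<open>auto simp: m'_def\<close>)
qed

text \<open>The parameter \<open>s\<close> is the perimeter.\<close>
definition long_triple :: "real \<Rightarrow> (nat \<Rightarrow> real) \<Rightarrow> nat \<Rightarrow> nat \<Rightarrow> nat \<Rightarrow> bool" where
  "long_triple s L i j m \<longleftrightarrow> s < 2 * (L i + L j) \<and> s < 2 * (L i + L m) \<and> s < 2 * (L j + L m)"

text \<open>The interval \<open>{lo..hi}\<close> records the possible lengths of the sum of the sides already deleted. If
  \<open>lo > 0\<close>, one of these sides, of length \<open>q\<close>, exceeds the sum \<open>r\<close> of the others, so that \<open>lo = q - r\<close>,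
  \<open>hi = q + r\<close>, and \<open>(lo + hi) / 2\<close> is the length of that side.\<close>
lemma chain_set_connected:
  assumes a: "\<And>i. 0 \<le> a i" and lo: "0 \<le> lo" "lo \<le> hi"
    and no_long: "\<And>i j m. i < j \<Longrightarrow> j < m \<Longrightarrow> m \<le> k \<Longrightarrow>
      \<not> long_triple (sum a {..<k} + hi) (a(k := (lo + hi) / 2)) i j m"
  shows "compact (chain_set a k lo hi) \<and> connected (chain_set a k lo hi)"
  using lo no_long
proof (induction k arbitrary: lo hi)
  case 0
  have "chain_set a 0 lo hi \<subseteq> {\<lambda>_. 0}" by (auto simp: chain_set_def)
  then have "chain_set a 0 lo hi = {} \<or> chain_set a 0 lo hi = {\<lambda>_. 0}" by blast
  then show ?case by auto
next
  case (Suc k)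
  define lo' where "lo' = max 0 (max (a k - hi) (lo - a k))"
  define hi' where "hi' = a k + hi"
  define W where "W = chain_set a k lo' hi'"
  define D where "D = {(z, \<zeta>). z \<in> W \<and> cmod \<zeta> = 1 \<and> lo \<le> cmod (chain_vec a k z + of_real (a k) * \<zeta>) \<and>
     cmod (chain_vec a k z + of_real (a k) * \<zeta>) \<le> hi}"
  note ak = a[of k]
  have lohi: "0 \<le> lo" "lo \<le> hi" by fact+
  have tot: "sum a {..<Suc k} + hi = sum a {..<k} + hi'" by (simp add: hi'_def)
  \<comment> \<open>For positive \<open>lo'\<close> the new half sum is the length of the side
    \<open>k\<close> or the old half sum, so a long triple for the shorter chain that uses it is
    already one for the longer chain.\<close>
  have q: "lo' = 0 \<or> (lo' + hi') / 2 = a k \<or> (lo' + hi') / 2 = (lo + hi) / 2"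
    using lohi ak by (auto simp: lo'_def hi'_def max_def)
  have IH: "compact W \<and> connected W"
    unfolding W_def
  proof (rule Suc.IH)
    show "0 \<le> lo'" "lo' \<le> hi'" using lohi ak by (auto simp: lo'_def hi'_def)
    fix i j m assume ijm: "i < j" "j < m" "m \<le> k"
    show "\<not> long_triple (sum a {..<k} + hi') (a(k := (lo' + hi') / 2)) i j m"
    proof (cases "m = k")
      case False
      then show ?thesis
        using Suc.prems(3)[OF ijm(1,2)] ijm unfolding tot by (simp add: long_triple_def)
    next
      case True
      consider "lo' = 0" | "(lo' + hi') / 2 = a k" | "(lo' + hi') / 2 = (lo + hi) / 2"
        using q by blast
      then show ?thesis
      proof cases
        case 1
        \<comment> \<open>Here the third length is \<open>hi' / 2\<close>, so the triple would force
          both \<open>a i\<close> and \<open>a j\<close> above half of \<open>sum a {..<k}\<close>,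
          which is impossible for two distinct sides.\<close>
        have "a i + a j = sum a {i, j}" using ijm by simp
        also have "\<dots> \<le> sum a {..<k}" using ijm a by (intro sum_mono2) auto
        finally show ?thesis using 1 ijm True by (auto simp: long_triple_def)
      next
        case 2
        then show ?thesis
          using Suc.prems(3)[of i j k] ijm True unfolding tot by (simp add: long_triple_def)
      next
        case 3
        then show ?thesis
          using Suc.prems(3)[of i j "Suc k"] ijm True unfolding tot 3 by (simp add: long_triple_def)
      qed
    qed
  qed
  have eq: "chain_set a (Suc k) lo hi = (\<lambda>(z, \<zeta>). z(k := \<zeta>)) ` D"
    unfolding D_def W_def by (rule chain_set_Suc) (use ak in \<open>auto simp: lo'_def hi'_def\<close>)
  have "compact D \<and> connected D"
  proof (cases "W = {}")
    case True
    then show ?thesis by (simp add: D_def)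
  next
    case False
    then obtain w where w: "w \<in> W" by blast
    define A where "A = sum a {..<k}"
    obtain m where m: "0 \<le> m" "m \<le> A" "m = 0 \<or> (\<exists>i<k. m = 2 * a i - A)"
      "\<And>r. m \<le> r \<Longrightarrow> r \<le> A \<Longrightarrow> chain_set a k r r \<noteq> {}"
      "\<And>z lo hi. z \<in> chain_set a k lo hi \<Longrightarrow> m \<le> cmod (chain_vec a k z) \<and> cmod (chain_vec a k z) \<le> sum a {..<k}"
      "\<And>z lo hi. z \<in> chain_set a k lo hi \<Longrightarrow> cmod (chain_vec a k z) \<le> A"
      unfolding A_def using chain_reach[of a k, OF a] by metis
    have w': "m \<le> hi'" "lo' \<le> A"
      using m(5)[OF w[unfolded W_def]] m(6)[OF w[unfolded W_def]] w by (auto simp: W_def chain_set_def)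
    \<comment> \<open>A collinear position is sought: the shorter chain has a sum of length
      \<open>r\<close>, and the side \<open>k\<close> points along this sum for
      \<open>\<epsilon> = 1\<close> and against it for \<open>\<epsilon> = - 1\<close>.\<close>
    obtain r \<epsilon> where r: "m \<le> r" "r \<le> A" "\<epsilon> = 1 \<or> \<epsilon> = - 1" "lo \<le> \<bar>r + \<epsilon> * a k\<bar>" "\<bar>r + \<epsilon> * a k\<bar> \<le> hi"
    proof -
      \<comment> \<open>In the first three cases \<open>r + a k\<close>, \<open>r - a k\<close> or
        \<open>a k - r\<close>, respectively, lies in \<open>{lo..hi}\<close> for some attainable
        \<open>r\<close> in \<open>{m..A}\<close>; the least such \<open>r\<close> is taken.\<close>
      consider "m + a k \<le> hi" | "lo + a k \<le> A" | "m + lo \<le> a k"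
        | "hi < m + a k" "A < lo + a k" "a k < m + lo"
        by linarith
      then show thesis
      proof cases
        case 1
        show thesis
          by (rule that[of "max m (lo - a k)" 1]) (use 1 w' lohi ak m in \<open>auto simp: lo'_def\<close>)
      next
        case 2
        show thesis
          by (rule that[of "max m (lo + a k)" "-1"]) (use 2 w' lohi ak m in \<open>auto simp: hi'_def\<close>)
      next
        case 3
        show thesis
          by (rule that[of "max m (a k - hi)" "-1"]) (use 3 w' lohi ak m in \<open>auto simp: lo'_def\<close>)
      next
        case 4
        \<comment> \<open>These inequalities rule out \<open>m = 0\<close>, so some side
          \<open>i\<close> has excess \<open>m\<close>; inserting \<open>m = 2 * a i - A\<close>
          turns them into the three conditions on \<open>i\<close>, \<open>k\<close> and
          \<open>Suc k\<close>.\<close>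
        then obtain i where i: "i < k" "m = 2 * a i - A" using m(3) lohi by auto
        then have "long_triple (sum a {..<Suc k} + hi) (a(Suc k := (lo + hi) / 2)) i k (Suc k)"
          using 4 by (auto simp: long_triple_def A_def field_simps)
        then show thesis using Suc.prems(3)[of i k "Suc k"] i by blast
      qed
    qed
    obtain z where z: "z \<in> chain_set a k r r" using m(4) r by blast
    have rz: "cmod (chain_vec a k z) = r" using z by (auto simp: chain_set_def)
    define t where "t = Arg (chain_vec a k z)"
    have vz: "chain_vec a k z = of_real r * cis t"
      unfolding t_def rz[symmetric] by (metis rcis_cmod_Arg rcis_def)
    define \<zeta> where "\<zeta> = of_real \<epsilon> * cis t"
    have "chain_vec a k z + of_real (a k) * \<zeta> = of_real (r + \<epsilon> * a k) * cis t"
      unfolding vz \<zeta>_def by (simp add: algebra_simps)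
    then have nz: "cmod (chain_vec a k z + of_real (a k) * \<zeta>) = \<bar>r + \<epsilon> * a k\<bar>"
      by (simp only: norm_mult norm_of_real norm_cis mult_1_right)
    have u: "cmod \<zeta> = 1" using r(3) by (auto simp: \<zeta>_def norm_mult)
    have "Im (cnj (chain_vec a k z) * \<zeta>) = 0"
      unfolding vz \<zeta>_def by (simp add: algebra_simps)
    moreover have "z \<in> W"
      using z nz r(4,5) norm_add_unit_bounds[OF u ak, of "chain_vec a k z"] rz norm_ge_zero[of "chain_vec a k z"]
      unfolding W_def chain_set_def lo'_def hi'_def by auto
    moreover have "(z, \<zeta>) \<in> D" using \<open>z \<in> W\<close> nz u r by (simp add: D_def)
    \<comment> \<open>The witness is the least length allowed by the triangle inequality and
      \<open>lo\<close>; it is at most \<open>hi\<close> by the choice of \<open>lo'\<close> and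
      \<open>hi'\<close>.\<close>
    moreover have "\<exists>r. \<bar>cmod (chain_vec a k y) - a k\<bar> \<le> r \<and> r \<le> cmod (chain_vec a k y) + a k \<and> lo \<le> r \<and> r \<le> hi"
      if "y \<in> W" for y
      using that lohi ak
      by (intro exI[of _ "max lo \<bar>cmod (chain_vec a k y) - a k\<bar>"])
        (auto simp: abs_le_iff add_increasing W_def chain_set_def lo'_def hi'_def)
    ultimately show ?thesis
      unfolding D_def using IH lohi ak
      by (intro conjI; intro extension_connected[of W "chain_vec a k" "a k" lo hi z \<zeta>] continuous_on_chain_vec) auto
  qed
  moreover have "continuous_on D (\<lambda>(z, \<zeta>). z(k := \<zeta>))"
    unfolding case_prod_unfold
  proof (rule continuous_on_coordinatewise_then_product)
    fix i
    have "continuous_on D (\<lambda>x. fst x i)"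
      by (rule continuous_on_compose2[OF continuous_on_product_coordinates[of i]]) (auto intro: continuous_intros)
    then show "continuous_on D (\<lambda>x. ((fst x)(k := snd x)) i)"
      by (cases "i = k") (auto intro: continuous_intros)
  qed
  ultimately show ?case
    unfolding eq by (intro conjI compact_continuous_image connected_continuous_image) auto
qed


section \<open>Long triples\<close>

text \<open>For collinear vectors the inner product is plus or minus the product of the norms;
  expanding the square leaves these two values.\<close>

lemma collinear_norm_add:
  fixes a b :: complex
  assumes "Im (cnj a * b) = 0"
  shows "cmod (a + b) = cmod a + cmod b \<or> cmod (a + b) = \<bar>cmod a - cmod b\<bar>"
proof -
  have n: "cmod (cnj a * b) = cmod a * cmod b" by (simp add: norm_mult)
  then have "\<bar>Re (cnj a * b)\<bar> = cmod a * cmod b"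
    using assms by (simp add: cmod_eq_Re)
  moreover have "(cmod (a + b))\<^sup>2 = (cmod a)\<^sup>2 + (cmod b)\<^sup>2 + 2 * Re (cnj a * b)"
    unfolding cmod_power2 by (simp add: power2_eq_square algebra_simps)
  ultimately have "(cmod (a + b))\<^sup>2 = (cmod a + cmod b)\<^sup>2 \<or> (cmod (a + b))\<^sup>2 = \<bar>cmod a - cmod b\<bar>\<^sup>2"
    unfolding power2_abs by (auto simp: power2_sum power2_diff abs_if split: if_splits)
  then show ?thesis
    by (metis abs_ge_zero add_nonneg_nonneg norm_ge_zero power2_eq_imp_eq)
qed

text \<open>If \<open>F i\<close> and \<open>F j\<close> pointed the same way, their sum would be
  longer than all other sides together; if opposite ways, \<open>F m\<close> would be longer than
  their sum and the remaining sides together. Either way the polygon could not close.\<close>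

lemma long_triple_not_collinear:
  assumes I: "finite I" "{i, j, m} \<subseteq> I" "i \<noteq> j" "i \<noteq> m" "j \<noteq> m"
    and closed: "(\<Sum>t\<in>I. F t) = 0"
    and long: "long_triple (\<Sum>t\<in>I. cmod (F t)) (\<lambda>t. cmod (F t)) i j m"
  shows "Im (cnj (F i) * F j) \<noteq> 0"
proof
  assume "Im (cnj (F i) * F j) = 0"
  then have col: "cmod (F i + F j) = cmod (F i) + cmod (F j) \<or> cmod (F i + F j) = \<bar>cmod (F i) - cmod (F j)\<bar>"
    by (rule collinear_norm_add)
  define R where "R = I - {i, j, m}"
  have split: "(\<Sum>t\<in>I. g t) = g i + g j + g m + (\<Sum>t\<in>R. g t)" for g :: "nat \<Rightarrow> 'a::comm_monoid_add"
    unfolding R_def using I by (subst sum.subset_diff[OF I(2,1)]) (simp add: ac_simps)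
  have "F i + F j + F m + sum F R = 0" using closed split[of F] by simp
  then have "F i + F j = - (F m + sum F R)" "F m = - (F i + F j + sum F R)"
    by (simp_all only: eq_neg_iff_add_eq_0 ac_simps)
  then have "cmod (F i + F j) = cmod (F m + sum F R)" "cmod (F m) = cmod (F i + F j + sum F R)"
    by (metis norm_minus_cancel)+
  moreover have "cmod (sum F R) \<le> (\<Sum>t\<in>R. cmod (F t))" by (rule norm_sum)
  ultimately have "cmod (F i + F j) \<le> cmod (F m) + (\<Sum>t\<in>R. cmod (F t))"
    "cmod (F m) \<le> cmod (F i + F j) + (\<Sum>t\<in>R. cmod (F t))"
    by (metis add_left_mono norm_triangle_le, metis add_left_mono norm_triangle_le)
  then show False
    using col long unfolding long_triple_def split[of "\<lambda>t. cmod (F t)"] by auto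
qed

text \<open>Two disjoint pairs of sides cannot both exceed half the perimeter. A side
  \<open>d\<close> in only one triple, with a second side \<open>e\<close> of that triple, leaves a
  pair of the other triple disjoint from both.\<close>

lemma long_triple_unique:
  assumes I: "finite I" "\<And>t. t \<in> I \<Longrightarrow> 0 \<le> L t"
    and 1: "long_triple (sum L I) L i j m" "{i, j, m} \<subseteq> I" "i < j" "j < m"
    and 2: "long_triple (sum L I) L i' j' m'" "{i', j', m'} \<subseteq> I" "i' < j'" "j' < m'"
  shows "i = i' \<and> j = j' \<and> m = m'"
proof -
  have pairs: False
    if "a \<noteq> b" "c \<noteq> d" "{a, b} \<inter> {c, d} = {}" "{a, b, c, d} \<subseteq> I"
      "sum L I < 2 * (L a + L b)" "sum L I < 2 * (L c + L d)" for a b c d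
  proof -
    have "L a + L b + (L c + L d) = sum L {a, b, c, d}" using that by auto
    also have "\<dots> \<le> sum L I" using that I by (intro sum_mono2) auto
    finally show False using that by simp
  qed
  have sub: "{i', j', m'} \<subseteq> {i, j, m}"
    if 1: "long_triple (sum L I) L i j m" "{i, j, m} \<subseteq> I" "i < j" "j < m"
    and 2: "long_triple (sum L I) L i' j' m'" "{i', j', m'} \<subseteq> I" "i' < j'" "j' < m'" for i j m i' j' m'
  proof (rule ccontr)
    assume "\<not> ?thesis"
    then obtain d where d: "d \<in> {i', j', m'}" "d \<notin> {i, j, m}" by blast
    define e where "e = (if d = i' then j' else i')"
    have e: "e \<noteq> d" "e \<in> I" "d \<in> I" "sum L I < 2 * (L d + L e)"
      using d 2 by (auto simp: e_def long_triple_def)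
    have l: "sum L I < 2 * (L i + L j)" "sum L I < 2 * (L i + L m)" "sum L I < 2 * (L j + L m)"
      using 1 by (auto simp: long_triple_def)
    consider "e = i" | "e = j" | "e \<noteq> i \<and> e \<noteq> j" by blast
    then show False
    proof cases
      case 1 then show False using pairs[of j m d e] l e d that(2-4) by auto
    next
      case 2 then show False using pairs[of i m d e] l e d that(2-4) by auto
    next
      case 3 then show False using pairs[of i j d e] l e d that(2-4) by auto
    qed
  qed
  have "{i, j, m} = {i', j', m'}"
    using sub[OF 1 2] sub[OF 2 1] by (rule subset_antisym[rotated])
  then have s: "i \<in> {i', j', m'}" "j \<in> {i', j', m'}" "m \<in> {i', j', m'}" by auto
  have "i' \<in> {i, j, m}" using \<open>{i, j, m} = {i', j', m'}\<close> by blast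
  then show ?thesis using s 1(3,4) 2(3,4) by auto
qed

section \<open>The moduli space as a quotient\<close>

text \<open>\<open>topology\<close> is known to return the given family of open sets only if that
  family is a topology, hence the check of intersections and unions.\<close>

lemma openin_quotient_topology:
  "openin (quotient_topology X f) U \<longleftrightarrow> U \<subseteq> f ` topspace X \<and> openin X {x \<in> topspace X. f x \<in> U}"
proof -
  have "istopology (\<lambda>U. U \<subseteq> f ` topspace X \<and> openin X {x \<in> topspace X. f x \<in> U})"
    unfolding istopology_def
  proof (intro conjI allI impI)
    fix S T assume "S \<subseteq> f ` topspace X \<and> openin X {x \<in> topspace X. f x \<in> S}"
      "T \<subseteq> f ` topspace X \<and> openin X {x \<in> topspace X. f x \<in> T}"
    moreover have "{x \<in> topspace X. f x \<in> S \<inter> T} = {x \<in> topspace X. f x \<in> S} \<inter> {x \<in> topspace X. f x \<in> T}"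
      by auto
    ultimately show "S \<inter> T \<subseteq> f ` topspace X" "openin X {x \<in> topspace X. f x \<in> S \<inter> T}" by auto
  next
    fix \<K> assume K: "\<forall>S\<in>\<K>. S \<subseteq> f ` topspace X \<and> openin X {x \<in> topspace X. f x \<in> S}"
    then show "\<Union>\<K> \<subseteq> f ` topspace X" by blast
    have "{x \<in> topspace X. f x \<in> \<Union>\<K>} = (\<Union>S\<in>\<K>. {x \<in> topspace X. f x \<in> S})" by auto
    then show "openin X {x \<in> topspace X. f x \<in> \<Union>\<K>}" using K by auto
  qed
  then show ?thesis
    unfolding quotient_topology_def by (simp add: topology_inverse')
qed

lemma topspace_quotient_topology: "topspace (quotient_topology X f) = f ` topspace X"
proof
  have "{x \<in> topspace X. f x \<in> f ` topspace X} = topspace X" by auto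
  then show "f ` topspace X \<subseteq> topspace (quotient_topology X f)"
    by (intro openin_subset) (simp add: openin_quotient_topology)
  show "topspace (quotient_topology X f) \<subseteq> f ` topspace X"
    using openin_topspace[of "quotient_topology X f"] unfolding openin_quotient_topology by blast
qed

lemma continuous_map_quotient_topology: "continuous_map X (quotient_topology X f) f"
  by (auto simp: continuous_map_def openin_quotient_topology topspace_quotient_topology)

text \<open>By \<open>sat\<close> and the covering, both sets are unions of fibres of
  \<open>f\<close>, so that their images are open and disjoint.\<close>

lemma not_connected_quotient_topology:
  assumes "openin X A" "openin X B" "A \<union> B = topspace X" "A \<noteq> {}" "B \<noteq> {}"
    and sat: "\<And>x y. x \<in> A \<Longrightarrow> y \<in> B \<Longrightarrow> f x \<noteq> f y"
  shows "\<not> connected_space (quotient_topology X f)"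
proof
  assume conn: "connected_space (quotient_topology X f)"
  have "{x \<in> topspace X. f x \<in> f ` A} = A" "{x \<in> topspace X. f x \<in> f ` B} = B"
    using assms(3) sat by (auto simp: image_iff) (metis UnE)+
  then have "openin (quotient_topology X f) (f ` A)" "openin (quotient_topology X f) (f ` B)"
    using assms(1-3) by (auto simp: openin_quotient_topology)
  moreover have "topspace (quotient_topology X f) \<subseteq> f ` A \<union> f ` B" "f ` A \<inter> f ` B = {}"
    using assms(3) sat by (auto simp: topspace_quotient_topology)
  ultimately show False
    using conn assms(4,5) unfolding connected_space_def by (metis image_is_empty)
qed

lemma openin_Collect_pos:
  assumes "continuous_map X euclideanreal g"
  shows "openin X {x \<in> topspace X. 0 < g x}"
  using openin_continuous_map_preimage[OF assms, of "{0<..}"] by simp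

lemma topspace_config_top: "topspace (config_top V E ends l) = config_space V E ends l"
  by (auto simp: config_top_def config_space_def PiE_def)

lemma continuous_map_config_coordinate:
  assumes "y \<in> V"
  shows "continuous_map (config_top V E ends l) euclidean (\<lambda>p. p y)"
  unfolding config_top_def
  by (intro continuous_map_from_subtopology continuous_map_product_projection assms)

lemma orbit_eqD:
  assumes "p \<in> extensional V" "orbit V p = orbit V q"
  obtains a b where "cmod a = 1" "\<And>y. y \<in> V \<Longrightarrow> p y = a * q y + b"
proof -
  have "p = restrict (\<lambda>y. 1 * p y + 0) V" using assms(1) by (simp add: extensional_restrict)
  then have "p \<in> orbit V p" unfolding orbit_def by (intro CollectI exI[of _ 1] exI[of _ 0]) simp
  then have "p \<in> orbit V q" using assms(2) by simp
  then obtain a b where "cmod a = 1" "p = restrict (\<lambda>y. a * q y + b) V" unfolding orbit_def by blast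
  then show thesis by (intro that[of a b]) auto
qed

lemma orbit_translate:
  assumes "\<And>y. y \<in> V \<Longrightarrow> q y = p y + c"
  shows "orbit V q = orbit V p"
proof -
  have sub: "orbit V q \<subseteq> orbit V p" if "\<And>y. y \<in> V \<Longrightarrow> q y = p y + c" for p q :: "'a \<Rightarrow> complex" and c
  proof
    fix f assume "f \<in> orbit V q"
    then obtain a b where a: "cmod a = 1" and f: "f = restrict (\<lambda>x. a * q x + b) V" unfolding orbit_def by blast
    have "f = restrict (\<lambda>x. a * p x + (a * c + b)) V"
      unfolding f by (rule restrict_ext) (simp add: that algebra_simps)
    then show "f \<in> orbit V p" unfolding orbit_def using a by blast
  qed
  show ?thesis
    using sub[of q p c] sub[of p q "- c"] assms by (intro subset_antisym) auto
qed

text \<open>The isometries preserve distances, so the choice in \<open>theta\<close> has a single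
  candidate.\<close>

lemma theta_orbit:
  assumes "s \<in> V" "t \<in> V"
  shows "theta s t (orbit V p) = cmod (p s - p t)"
proof -
  have "cmod (q s - q t) = cmod (p s - p t)" if q: "q \<in> orbit V p" for q
  proof -
    obtain a b where "cmod a = 1" "q = restrict (\<lambda>x. a * p x + b) V" using q unfolding orbit_def by blast
    then have "q s - q t = a * (p s - p t)" "cmod a = 1" using assms by (simp_all add: algebra_simps)
    then show ?thesis by (simp add: norm_mult)
  qed
  moreover have "orbit V p \<noteq> {}" unfolding orbit_def using norm_one by blast
  ultimately show ?thesis unfolding theta_def by (intro some_equality) auto
qed

section \<open>Path linkages\<close>

lemma path_config_space:
  assumes "length xs = length es + 1"
    and "\<forall>j<length es. endpts ends (es ! j) = {xs ! j, xs ! Suc j}"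
  shows "p \<in> config_space V (set es) ends l \<longleftrightarrow>
    p \<in> extensional V \<and> (\<forall>j<length es. cmod (p (xs ! Suc j) - p (xs ! j)) = l (es ! j))"
proof -
  have "cmod (p (fst (ends (es ! j))) - p (snd (ends (es ! j)))) = cmod (p (xs ! Suc j) - p (xs ! j))"
    if "j < length es" for j
  proof -
    have "{fst (ends (es ! j)), snd (ends (es ! j))} = {xs ! j, xs ! Suc j}"
      using assms(2) that by (simp add: endpts_def)
    then show ?thesis by (auto simp: doubleton_eq_iff norm_minus_commute)
  qed
  then show ?thesis
    unfolding config_space_def by (auto simp: all_set_conv_all_nth)
qed

lemma path_verts:
  assumes "es \<noteq> []" "length xs = length es + 1"
    and "\<forall>j<length es. endpts ends (es ! j) = {xs ! j, xs ! Suc j}"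
  shows "verts ends (set es) = set xs"
proof -
  have "verts ends (set es) = (\<Union>j<length es. {xs ! j, xs ! Suc j})"
    unfolding verts_def set_conv_nth[of es] using assms(3) by auto
  also have "\<dots> = (!) xs ` {..<length xs}"
  proof (intro equalityI subsetI)
    fix y assume "y \<in> (!) xs ` {..<length xs}"
    then obtain n where n: "y = xs ! n" "n < Suc (length es)" using assms(2) by auto
    show "y \<in> (\<Union>j<length es. {xs ! j, xs ! Suc j})"
    proof (cases n)
      case 0
      then show ?thesis using n assms(1) by (intro UN_I[of 0]) auto
    next
      case (Suc k)
      then show ?thesis using n by (intro UN_I[of k]) auto
    qed
  qed (use assms(2) in auto)
  also have "\<dots> = set xs" by (auto simp: in_set_conv_nth)
  finally show ?thesis .
qed

text \<open>Every configuration of the path can be translated to start at the origin, where it is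
  given by the directions of its edges. So the fibre of \<open>theta\<close> is a continuous image
  of the space of chains.\<close>

lemma path_fibre_connected:
  assumes len: "length xs = length es + 1" and dist: "distinct xs"
    and inc: "\<forall>j<length es. endpts ends (es ! j) = {xs ! j, xs ! Suc j}"
    and a: "\<And>j. j < length es \<Longrightarrow> a j = l (es ! j)" "\<And>j. 0 \<le> a j"
    and conn: "connected (chain_set a (length es) x x)"
  shows "connectedin (moduli_top (set xs) (set es) ends l)
    {c \<in> moduli_space (set xs) (set es) ends l. theta (hd xs) (last xs) c = x}"
proof -
  define V where "V = set xs"
  define K where "K = length es"
  define idx where "idx = inv_into {..K} ((!) xs)"
  define build where "build z = restrict (\<lambda>y. chain_vec a (idx y) z) V" for z
  have inj: "inj_on ((!) xs) {..K}"
    using dist len by (auto simp: K_def inj_on_def nth_eq_iff_index_eq)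
  have idx: "idx (xs ! n) = n" if "n \<le> K" for n
    unfolding idx_def using inj that by (intro inv_into_f_f) auto
  have xsV: "xs ! n \<in> V" if "n \<le> K" for n
    using that len by (simp add: V_def K_def)
  have xsE: "\<exists>n\<le>K. y = xs ! n" if "y \<in> V" for y
    using that len by (auto simp: V_def K_def in_set_conv_nth less_Suc_eq_le)
  have xs: "xs \<noteq> []" using len by auto
  have ends: "hd xs = xs ! 0" "last xs = xs ! K"
    using xs len by (simp_all add: hd_conv_nth last_conv_nth K_def)
  have build_nth: "build z (xs ! n) = chain_vec a n z" if "n \<le> K" for z n
    using that by (simp add: build_def idx xsV)
  have cfg: "p \<in> config_space V (set es) ends l \<longleftrightarrow>
    p \<in> extensional V \<and> (\<forall>j<K. cmod (p (xs ! Suc j) - p (xs ! j)) = a j)" for p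
    using path_config_space[OF len inc, of p V l] a(1) by (simp add: K_def)
  have build_cfg: "build z \<in> config_space V (set es) ends l" if "z \<in> chain_set a K x x" for z
    unfolding cfg
  proof (intro conjI allI impI)
    fix j assume "j < K"
    then have "build z (xs ! Suc j) - build z (xs ! j) = of_real (a j) * z j"
      by (simp add: build_nth chain_vec_def)
    then show "cmod (build z (xs ! Suc j) - build z (xs ! j)) = a j"
      using that \<open>j < K\<close> a(2)[of j] by (simp add: norm_mult chain_set_def)
  qed (simp add: build_def)
  have build_theta: "theta (hd xs) (last xs) (orbit V (build z)) = x" if "z \<in> chain_set a K x x" for z
    using that theta_orbit[OF xsV[of 0] xsV[of K]]
    by (simp add: ends build_nth chain_vec_def[of a 0] chain_set_def)
  have "continuous_map (top_of_set (chain_set a K x x)) (config_top V (set es) ends l) build"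
    unfolding config_top_def continuous_map_in_subtopology continuous_map_componentwise
  proof (intro conjI ballI)
    fix y assume "y \<in> V"
    then have "(\<lambda>z. build z y) = chain_vec a (idx y)" by (simp add: build_def)
    then show "continuous_map (top_of_set (chain_set a K x x)) euclidean (\<lambda>z. build z y)"
      by (simp add: continuous_on_chain_vec)
  qed (use build_cfg in \<open>auto simp: build_def[abs_def]\<close>)
  then have "continuous_map (top_of_set (chain_set a K x x)) (moduli_top V (set es) ends l) (orbit V \<circ> build)"
    unfolding moduli_top_def by (rule continuous_map_compose[OF _ continuous_map_quotient_topology])
  then have "connectedin (moduli_top V (set es) ends l) ((orbit V \<circ> build) ` chain_set a K x x)"
    by (rule connectedin_continuous_map_image)
      (use conn in \<open>simp add: connectedin_subtopology K_def\<close>)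
  moreover have "(orbit V \<circ> build) ` chain_set a K x x =
    {c \<in> moduli_space V (set es) ends l. theta (hd xs) (last xs) c = x}"
  proof (intro set_eqI iffI)
    fix c assume "c \<in> {c \<in> moduli_space V (set es) ends l. theta (hd xs) (last xs) c = x}"
    then obtain p where p: "p \<in> config_space V (set es) ends l" and c: "c = orbit V p"
      and x: "theta (hd xs) (last xs) c = x" by (auto simp: moduli_space_def)
    have x: "cmod (p (xs ! K) - p (xs ! 0)) = x"
      using x theta_orbit[OF xsV[of 0] xsV[of K], of p] by (simp add: c ends norm_minus_commute)
    \<comment> \<open>An edge of length 0 has no direction and receives 1; beyond the path the value
      0 is the convention of \<open>chain_set\<close>.\<close>
    define z where "z j = (if j < K then if a j = 0 then 1 else (p (xs ! Suc j) - p (xs ! j)) / of_real (a j) else 0)" for j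
    have step: "of_real (a j) * z j = p (xs ! Suc j) - p (xs ! j)" if "j < K" for j
      using p that unfolding cfg z_def by auto
    have vec: "chain_vec a n z = p (xs ! n) - p (xs ! 0)" if "n \<le> K" for n
      using that
    proof (induction n)
      case (Suc n)
      then show ?case using step[of n] by (simp add: chain_vec_def)
    qed (simp add: chain_vec_def)
    have "cmod (z j) = 1" if "j < K" for j
      using p that a(2)[of j] unfolding cfg z_def by (auto simp: norm_divide)
    then have "z \<in> chain_set a K x x"
      using x vec[of K] by (auto simp: chain_set_def z_def)
    moreover have "c = orbit V (build z)"
      unfolding c
    proof (rule orbit_translate)
      fix y assume "y \<in> V"
      then obtain n where "n \<le> K" "y = xs ! n" using xsE by blast
      then show "p y = build z y + p (xs ! 0)" by (simp add: build_nth vec)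
    qed
    ultimately show "c \<in> (orbit V \<circ> build) ` chain_set a K x x" by auto
  qed (use build_cfg build_theta in \<open>auto simp: moduli_space_def\<close>)
  ultimately show ?thesis by (simp add: V_def)
qed
section \<open>Disconnectedness\<close>

theorem mainTheorem12:
  fixes V :: "'v set" and E :: "'e set" and ends :: "'e \<Rightarrow> 'v \<times> 'v" and l :: "'e \<Rightarrow> real"
    and u v :: 'v and n :: nat and P :: "nat \<Rightarrow> 'e set" and K :: "'e set"
  assumes G: "graph V E ends"
    and l_nonneg: "\<forall>e\<in>E. l e \<ge> 0"
    and M_nonempty: "moduli_space V E ends l \<noteq> {}"
    and uv: "u \<noteq> v" "u \<in> V" "v \<in> V"
    and n2: "n \<ge> 2"
    and E_decomp: "E = (\<Union>i<n. P i) \<union> K"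
    and V_decomp: "V = (\<Union>i<n. verts ends (P i)) \<union> verts ends K"
    and P_disj: "\<forall>i<n. \<forall>j<n. i \<noteq> j \<longrightarrow> P i \<inter> P j = {} \<and> verts ends (P i) \<inter> verts ends (P j) \<subseteq> {u, v}"
    and PK_disj: "\<forall>i<n. P i \<inter> K = {} \<and> verts ends (P i) \<inter> verts ends K \<subseteq> {u, v}"
    and P_path: "\<forall>i<n. is_path ends (P i) u v"
    and P_pos: "\<forall>i<n. \<forall>e\<in>P i. l e > 0"
    and K_sp: "K = {} \<or> ttspg ends K u v"
    and gap: "\<exists>i<n. nabla (verts ends (P i)) (P i) ends l u v \<inter> dist_range V E ends l u v = {}"
  shows "\<not> connected_space (moduli_top V E ends l)"
proof -

  \<comment> \<open>The chosen path, closed by its diagonal to a polygon\<close>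
  obtain i0 where i0: "i0 < n" "nabla (verts ends (P i0)) (P i0) ends l u v \<inter> dist_range V E ends l u v = {}"
    using gap by blast
  obtain xs es where path: "es \<noteq> []" "length xs = length es + 1" "distinct xs"
      "hd xs = u" "last xs = v" "set es = P i0"
      "\<forall>j<length es. endpts ends (es ! j) = {xs ! j, xs ! Suc j}"
    using P_path i0(1) unfolding is_path_def by blast
  define N where "N = length es"
  define a where "a j = (if j < N then l (es ! j) else 0)" for j
  have verts: "verts ends (set es) = set xs" by (rule path_verts[OF path(1,2,7)])
  have esE: "set es \<subseteq> E" using path(6) i0(1) E_decomp by blast
  have xsV: "set xs \<subseteq> V" unfolding verts[symmetric] path(6) V_decomp using i0(1) by blast
  have nthV: "xs ! j \<in> V" if "j \<le> N" for j
    using that path(2) xsV by (simp add: N_def subset_iff)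
  have a_nonneg: "0 \<le> a j" for j
    using l_nonneg esE by (auto simp: a_def N_def subset_iff)
  let ?C = "config_space V E ends l" and ?T = "config_top V E ends l"

  text \<open>The index \<open>N\<close> stands for the diagonal from \<open>v\<close> back to \<open>u\<close>, which closes the path to a polygon.\<close>
  define F where "F p j = (if j < N then p (xs ! Suc j) - p (xs ! j) else p u - p v)" for p :: "'v \<Rightarrow> complex" and j
  define L where "L p = a(N := cmod (p u - p v))" for p :: "'v \<Rightarrow> complex"
  define long where "long p i j m \<longleftrightarrow> long_triple (sum (L p) {..N}) (L p) i j m" for p i j m
  have xs0: "xs \<noteq> []" using path(2) by auto
  have uv_nth: "u = xs ! 0" "v = xs ! N"
    using xs0 path(2,4,5) by (auto simp: hd_conv_nth last_conv_nth N_def)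
  have sumL: "sum (L p) {..N} = sum a {..<N} + cmod (p u - p v)" for p
    by (simp add: L_def flip: lessThan_Suc_atMost)
  have F_closed: "(\<Sum>j\<le>N. F p j) = 0" for p
  proof -
    have "(\<Sum>j<N. F p j) = (\<Sum>j<N. p (xs ! Suc j) - p (xs ! j))" by (simp add: F_def)
    also have "\<dots> = p v - p u" unfolding uv_nth by (rule sum_lessThan_telescope)
    finally show ?thesis by (simp add: F_def flip: lessThan_Suc_atMost)
  qed
  have restr: "restrict p (set xs) \<in> config_space (set xs) (set es) ends l" if "p \<in> ?C" for p
    using that esE verts unfolding config_space_def verts_def endpts_def by auto
  have F_norm: "cmod (F p j) = L p j" if "p \<in> ?C" "j \<le> N" for p j
  proof (cases "j < N")
    case True
    then have "xs ! j \<in> set xs" "xs ! Suc j \<in> set xs" using path(2) by (auto simp: N_def)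
    moreover have "cmod (restrict p (set xs) (xs ! Suc j) - restrict p (set xs) (xs ! j)) = l (es ! j)"
      using True restr[OF that(1)] unfolding path_config_space[OF path(2,7)] N_def by blast
    ultimately show ?thesis
      using True by (simp add: F_def L_def a_def)
  qed (use that in \<open>simp add: F_def L_def\<close>)
  have not_collinear: "Im (cnj (F p i) * F p j) \<noteq> 0"
    if "p \<in> ?C" "long p i j m" "i < j" "j < m" "m \<le> N" for p i j m
  proof (rule long_triple_not_collinear[of "{..N}" i j m])
    have "(\<Sum>t\<le>N. cmod (F p t)) = sum (L p) {..N}" using F_norm that(1) by simp
    then show "long_triple (\<Sum>t\<le>N. cmod (F p t)) (\<lambda>t. cmod (F p t)) i j m"
      using that F_norm[OF that(1)] by (simp add: long_def long_triple_def)
  qed (use that F_closed in auto)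
  \<comment> \<open>Otherwise the distance \<open>x\<close> would have a connected fibre, hence lie
    in \<open>nabla\<close> of the path as well as in \<open>dist_range\<close>, against the choice
    of \<open>i0\<close>.\<close>
  have long_ex: "\<exists>i j m. i < j \<and> j < m \<and> m \<le> N \<and> long p i j m" if p: "p \<in> ?C" for p
  proof (rule ccontr)
    assume none: "\<not> ?thesis"
    define x where "x = cmod (p u - p v)"
    let ?q = "restrict p (set xs)"
    have mem: "u \<in> set xs" "v \<in> set xs" using path(4,5) xs0 by auto
    then have "theta u v (orbit (set xs) ?q) = x" by (simp add: theta_orbit x_def)
    then have "x \<in> theta u v ` moduli_space (set xs) (set es) ends l"
      using restr[OF p] unfolding moduli_space_def by (metis imageI)
    moreover have "x \<in> dist_range V E ends l u v"
      using p by (auto simp: dist_range_def x_def)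
    ultimately have "\<not> connectedin (moduli_top (set xs) (set es) ends l)
        {c \<in> moduli_space (set xs) (set es) ends l. theta u v c = x}"
      using i0(2) verts unfolding path(6) nabla_def by auto
    then have "\<not> connected (chain_set a N x x)"
      using path_fibre_connected[OF path(2,3,7), of a l x] a_nonneg
      unfolding path(4,5) by (auto simp: a_def N_def)
    \<comment> \<open>With both bounds equal to \<open>x\<close>, their half sum is \<open>x\<close>
      itself, the length of the diagonal at index \<open>N\<close>.\<close>
    moreover have "connected (chain_set a N x x)"
      using none chain_set_connected[OF a_nonneg, of x x N] unfolding long_def sumL
      by (auto simp: L_def x_def)
    ultimately show False by blast
  qed
  have long_unique: "i = i' \<and> j = j' \<and> m = m'"
    if "long p i j m" "i < j" "j < m" "m \<le> N" "long p i' j' m'" "i' < j'" "j' < m'" "m' \<le> N"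
    for p i j m i' j' m'
    using that unfolding long_def
    by (intro long_triple_unique[of "{..N}" "L p"]) (auto simp: L_def a_nonneg)

  \<comment> \<open>Continuity of the sides on the configuration space\<close>
  have cont_at: "continuous_map ?T euclidean (\<lambda>p. p y)" if "y \<in> V" for y
    by (rule continuous_map_config_coordinate[OF that])
  have cont_F: "continuous_map ?T euclidean (\<lambda>p. F p j)" for j
    unfolding F_def using nthV uv
    by (cases "j < N") (auto intro!: continuous_map_diff cont_at)
  have cont_L: "continuous_map ?T euclideanreal (\<lambda>p. L p j)" for j
    unfolding L_def using uv
    by (cases "j = N") (auto intro!: continuous_map_norm continuous_map_diff cont_at)
  have open_long: "openin ?T {p \<in> ?C. long p i j m}" for i j m
  proof -
    have op: "openin ?T {p \<in> topspace ?T. 0 < 2 * (L p i + L p j) - sum (L p) {..N}}" for i j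
      by (intro openin_Collect_pos continuous_map_diff continuous_map_real_mult continuous_map_add
          continuous_map_sum cont_L) auto
    have "{p \<in> ?C. long p i j m} = {p \<in> topspace ?T. 0 < 2 * (L p i + L p j) - sum (L p) {..N}} \<inter>
        {p \<in> topspace ?T. 0 < 2 * (L p i + L p m) - sum (L p) {..N}} \<inter>
        {p \<in> topspace ?T. 0 < 2 * (L p j + L p m) - sum (L p) {..N}}"
      by (auto simp: long_def long_triple_def topspace_config_top)
    then show ?thesis using op by (simp only:) (intro openin_Int op)
  qed

  \<comment> \<open>Separation by the sign of a determinant\<close>
  obtain p0 where p0: "p0 \<in> ?C" using M_nonempty by (auto simp: moduli_space_def)
  obtain i j m where ijm: "i < j" "j < m" "m \<le> N" and long0: "long p0 i j m"
    using long_ex[OF p0] by blast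
  \<comment> \<open>The determinant of two sides of the path itself, since \<open>i < j\<close> and
    \<open>j < N\<close>.\<close>
  define dt where "dt p = Im (cnj (F p i) * F p j)" for p
  have cont_dt: "continuous_map ?T euclideanreal dt"
  proof -
    have "continuous_map ?T euclideanreal ((\<lambda>(w, z). Im (cnj w * z)) \<circ> (\<lambda>p. (F p i, F p j)))"
    proof (rule continuous_map_compose)
      show "continuous_map ?T (prod_topology euclidean euclidean) (\<lambda>p. (F p i, F p j))"
        by (intro continuous_map_pairedI cont_F)
      show "continuous_map (prod_topology euclidean euclidean) euclideanreal (\<lambda>(w, z). Im (cnj w * z))"
        by (simp add: case_prod_unfold) (intro continuous_intros)
    qed
    then show ?thesis by (simp add: o_def dt_def[abs_def])
  qed
  define A where "A = {p \<in> ?C. long p i j m \<and> 0 < dt p}"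
  \<comment> \<open>Negative sign or another long triple: a union of open sets, which turns out to
    be the complement of \<open>A\<close>.\<close>
  define B where "B = {p \<in> ?C. long p i j m \<and> dt p < 0} \<union>
     (\<Union>(i', j', m') \<in> {(i', j', m'). i' < j' \<and> j' < m' \<and> m' \<le> N \<and> (i', j', m') \<noteq> (i, j, m)}.
        {p \<in> ?C. long p i' j' m'})"
  have "openin ?T A"
  proof -
    have "A = {p \<in> ?C. long p i j m} \<inter> {p \<in> topspace ?T. 0 < dt p}"
      by (auto simp: A_def topspace_config_top)
    then show ?thesis using open_long openin_Collect_pos[OF cont_dt] by auto
  qed
  moreover have "openin ?T B"
  proof -
    have "{p \<in> ?C. long p i j m \<and> dt p < 0} = {p \<in> ?C. long p i j m} \<inter> {p \<in> topspace ?T. 0 < - dt p}"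
      by (auto simp: topspace_config_top)
    moreover have "openin ?T {p \<in> topspace ?T. 0 < - dt p}"
      by (intro openin_Collect_pos continuous_map_minus cont_dt)
    ultimately show ?thesis
      unfolding B_def using open_long by (intro openin_Un openin_Union) auto
  qed
  moreover have "A \<union> B = topspace ?T"
  proof -
    have "p \<in> A \<union> B" if p: "p \<in> ?C" for p
    proof -
      obtain i' j' m' where t: "i' < j'" "j' < m'" "m' \<le> N" "long p i' j' m'"
        using long_ex[OF p] by blast
      show ?thesis
      proof (cases "(i', j', m') = (i, j, m)")
        case True
        then have "dt p \<noteq> 0" unfolding dt_def using not_collinear[OF p t(4,1,2,3)] by simp
        then show ?thesis using True p t by (auto simp: A_def B_def)
      next
        case False
        then show ?thesis using p t unfolding B_def by blast
      qed
    qed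
    then show ?thesis by (auto simp: A_def B_def topspace_config_top)
  qed
  moreover have "A \<noteq> {} \<and> B \<noteq> {}"
  proof -
    \<comment> \<open>The mirror image of \<open>p0\<close> has the same lengths and the opposite
      determinant, so one of the two configurations is in \<open>A\<close> and the other in
      \<open>B\<close>.\<close>
    define q where "q = restrict (\<lambda>y. cnj (p0 y)) V"
    have qV: "q y = cnj (p0 y)" if "y \<in> V" for y using that by (simp add: q_def)
    have cn: "cmod (cnj w - cnj z) = cmod (w - z)" for w z
      by (metis complex_cnj_diff complex_mod_cnj)
    have q: "q \<in> ?C"
      using p0 G unfolding config_space_def graph_def
      by (auto simp: qV cn) (simp add: q_def)
    have "cmod (q u - q v) = cmod (p0 u - p0 v)" using uv by (simp add: qV cn)
    then have "L q = L p0" by (simp add: L_def)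
    then have "long q i j m" using long0 by (simp add: long_def)
    moreover have "dt q = - dt p0"
    proof -
      have "F q t = cnj (F p0 t)" if "t < N" for t
        using that nthV by (simp add: F_def qV)
      then show ?thesis using ijm by (simp add: dt_def algebra_simps)
    qed
    moreover have "dt p0 \<noteq> 0"
      unfolding dt_def using not_collinear[OF p0 long0 ijm] .
    ultimately show ?thesis
      using p0 q long0 unfolding A_def B_def by (cases "0 < dt p0") auto
  qed
  moreover have "orbit V p \<noteq> orbit V q" if p: "p \<in> A" and q: "q \<in> B" for p q
  proof
    assume "orbit V p = orbit V q"
    moreover have "p \<in> extensional V" using p by (simp add: A_def config_space_def)
    ultimately obtain c d where cd: "cmod c = 1" "\<And>y. y \<in> V \<Longrightarrow> p y = c * q y + d"
      using orbit_eqD by blast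
    \<comment> \<open>The isometry multiplies every side, diagonal included, by the same unit
      \<open>c\<close>, which preserves lengths and determinants.\<close>
    have F: "F p t = c * F q t" for t
      using nthV uv by (simp add: F_def cd algebra_simps)
    have "p u - p v = c * (q u - q v)" using uv by (simp add: cd algebra_simps)
    then have "L p = L q" using cd(1) by (simp add: L_def norm_mult)
    then have longpq: "long p = long q" by (simp add: long_def[abs_def])
    have "cnj (F p i) * F p j = (c * cnj c) * (cnj (F q i) * F q j)"
      by (simp add: F algebra_simps)
    also have "c * cnj c = 1" using cd(1) by (simp add: complex_norm_square[symmetric])
    finally have "dt p = dt q" by (simp add: dt_def)
    then have "0 < dt q" "long q i j m" using p longpq by (auto simp: A_def)
    \<comment> \<open>Since \<open>dt q\<close> is positive, membership in \<open>B\<close> must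
      come from a different long triple, against uniqueness.\<close>
    moreover obtain i' j' m' where "i' < j'" "j' < m'" "m' \<le> N" "(i', j', m') \<noteq> (i, j, m)" "long q i' j' m'"
      using q \<open>0 < dt q\<close> unfolding B_def by auto
    ultimately show False
      using long_unique[of q i j m i' j' m'] ijm by blast
  qed
  ultimately show ?thesis
    unfolding moduli_top_def by (intro not_connected_quotient_topology[of _ A B]) auto
qed

end
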